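(* Let $k$ be a field of characteristic $\neq 2$, $n$ a positive integer and $C_n$ the cyclic group of order $n$ generated by $c$. Then there exists a bijective correspondence between the set of all matched pairs of Hopf algebras $(H_4, k[C_n], \triangleleft, \triangleright)$ and $U_n(k)$ such that the matched pair $(\triangleleft, \triangleright)$ corresponding to an $n$-th root of unity $\omega \in U_n(k)$ is given, for all $i = 0, 1, \ldots, n-1$, by $$c^i \triangleleft 1 = c^i, \quad c^i \triangleleft g = c^i, \quad c^i \triangleleft x = 0, \quad c^i \triangleleft gx = 0,$$ $$c^i \triangleright 1 = 1, \quad c^i \triangleright g = g, \quad c^i \triangleright x = \omega^i x, \quad c^i \triangleright gx = \omega^i gx.$$
   Context: $U_n(k) = \{\omega \in k \mid \omega^n = 1\}$ is the group of $n$-th roots of unity in $k$. $k[C_n]$ is the group Hopf algebra. $H_4$ is Sweedler's $4$-dimensional Hopf algebra with $k$-basis $\{1, g, x, gx\}$, relations $g^2 = 1$, $x^2 = 0$, $xg = -gx$, and $\Delta(g) = g \otimes g$, $\Delta(x) = x \otimes 1 + g \otimes x$, $\varepsilon(g) = 1$, $\varepsilon(x) = 0$, $S(g) = g$, $S(x) = -gx$. All Hopf algebras and tensor products are over $k$; Sweedler notation is used. A matched pair of Hopf algebras is a system $(A, H, \triangleleft, \triangleright)$ where $A, H$ are Hopf algebras, $\triangleleft : H \otimes A \to H$, $\triangleright: H \otimes A \to A$ are coalgebra maps such that $(A, \triangleright)$ is a left $H$-module, $(H, \triangleleft)$ is a right $A$-module, and for all $a, b \in A$, $y, h \in H$: $h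 \triangleright 1_A = \varepsilon_H(h) 1_A$, $1_H \triangleleft a = \varepsilon_A(a) 1_H$; $y \triangleright (ab) = (y_{(1)} \triangleright a_{(1)}) \bigl( (y_{(2)} \triangleleft a_{(2)}) \triangleright b \bigr)$; $(yh) \triangleleft a = \bigl( y \triangleleft (h_{(1)} \triangleright a_{(1)}) \bigr)(h_{(2)} \triangleleft a_{(2)})$; $y_{(1)} \triangleleft a_{(1)} \otimes y_{(2)} \triangleright a_{(2)} = y_{(2)} \triangleleft a_{(2)} \otimes y_{(1)} \triangleright a_{(1)}$. *)

theory Defs
  imports Complex_Main "HOL-Library.Poly_Mapping" "HOL-Library.Cardinality"
begin

section \<open>Vector spaces with a basis and their tensor products\<close>

text \<open>
  Vector spaces over a field \<open>'k\<close> are taken with a chosen basis \<open>'a\<close>, i.e. in the form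
  \<open>'a \<Rightarrow>\<^sub>0 'k\<close> (finitely supported functions); this is no restriction, as every vector
  space has a basis.  Linearity is the library's
  \<open>Vector_Spaces.linear\<close>.
\<close>

definition smul :: "'k::field \<Rightarrow> ('a \<Rightarrow>\<^sub>0 'k) \<Rightarrow> ('a \<Rightarrow>\<^sub>0 'k)" where
  "smul r v = Poly_Mapping.map (\<lambda>s. r * s) v"

abbreviation bv :: "'a \<Rightarrow> ('a \<Rightarrow>\<^sub>0 'k::field)" where
  "bv a \<equiv> Poly_Mapping.single a 1"

lemma lookup_smul [simp]: "Poly_Mapping.lookup (smul r v) a = r * Poly_Mapping.lookup v a"
  by (simp add: smul_def Poly_Mapping.map.rep_eq when_def)

interpretation free_vs: vector_space "smul :: 'k::field \<Rightarrow> ('a \<Rightarrow>\<^sub>0 'k) \<Rightarrow> _"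
  by unfold_locales (auto intro!: poly_mapping_eqI simp: lookup_add algebra_simps)

definition linear_extension :: "('a \<Rightarrow> ('b \<Rightarrow>\<^sub>0 'k)) \<Rightarrow> ('a \<Rightarrow>\<^sub>0 'k) \<Rightarrow> ('b \<Rightarrow>\<^sub>0 'k::field)" where
  "linear_extension f v = (\<Sum>a\<in>Poly_Mapping.keys v. smul (Poly_Mapping.lookup v a) (f a))"

definition bilinear_map ::
  "(('a \<Rightarrow>\<^sub>0 'k) \<Rightarrow> ('b \<Rightarrow>\<^sub>0 'k) \<Rightarrow> ('c \<Rightarrow>\<^sub>0 'k::field)) \<Rightarrow> bool" where
  "bilinear_map F \<longleftrightarrow>
     (\<forall>v. Vector_Spaces.linear smul smul (\<lambda>w. F v w)) \<and>
     (\<forall>w. Vector_Spaces.linear smul smul (\<lambda>v. F v w))"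

text \<open>
  The tensor product of the spaces with bases \<open>'a\<close> and \<open>'b\<close> is the space with basis
  \<open>'a \<times> 'b\<close>; the pair \<open>(a, b)\<close> stands for the tensor of the two basis vectors.
  The universal property is proved below.
\<close>

definition tensor ::
  "('a \<Rightarrow>\<^sub>0 'k) \<Rightarrow> ('b \<Rightarrow>\<^sub>0 'k) \<Rightarrow> (('a \<times> 'b) \<Rightarrow>\<^sub>0 'k::field)"  (infixr "\<otimes>" 75) where
  "v \<otimes> w = (\<Sum>a\<in>Poly_Mapping.keys v. \<Sum>b\<in>Poly_Mapping.keys w.
     Poly_Mapping.single (a, b) (Poly_Mapping.lookup v a * Poly_Mapping.lookup w b))"

text \<open>
  The linear map on the tensor product induced by a bilinear map \<open>F\<close>.  It renders Sweedler
  notation: \<open>sweedler (\<lambda>h1 h2. F h1 h2) (\<Delta> h)\<close> is $F(h_{(1)}, h_{(2)})$.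
\<close>

definition sweedler ::
  "(('a \<Rightarrow>\<^sub>0 'k) \<Rightarrow> ('b \<Rightarrow>\<^sub>0 'k) \<Rightarrow> ('c \<Rightarrow>\<^sub>0 'k)) \<Rightarrow> (('a \<times> 'b) \<Rightarrow>\<^sub>0 'k) \<Rightarrow> ('c \<Rightarrow>\<^sub>0 'k::field)" where
  "sweedler F = linear_extension (\<lambda>(a, b). F (bv a) (bv b))"

lemma lookup_tensor [simp]: "Poly_Mapping.lookup (v \<otimes> w) (a, b) = Poly_Mapping.lookup v a * Poly_Mapping.lookup w b"
proof -
  have "Poly_Mapping.lookup (v \<otimes> w) (a, b) =
    (\<Sum>x\<in>Poly_Mapping.keys v. \<Sum>y\<in>Poly_Mapping.keys w. (if x = a then if y = b then Poly_Mapping.lookup v x * Poly_Mapping.lookup w y else 0 else 0))"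
    unfolding tensor_def lookup_sum
    by (intro sum.cong refl) (auto simp: lookup_single when_def)
  also have "\<dots> = (\<Sum>x\<in>Poly_Mapping.keys v. if x = a then Poly_Mapping.lookup v x * Poly_Mapping.lookup w b else 0)"
    by (intro sum.cong refl) (auto simp: in_keys_iff)
  also have "\<dots> = Poly_Mapping.lookup v a * Poly_Mapping.lookup w b"
    by (auto simp: in_keys_iff)
  finally show ?thesis .
qed

lemma basis_expansion: "v = (\<Sum>a\<in>Poly_Mapping.keys v. smul (Poly_Mapping.lookup v a) (bv a))"
proof (rule poly_mapping_eqI)
  fix b
  have "Poly_Mapping.lookup (\<Sum>a\<in>Poly_Mapping.keys v. smul (Poly_Mapping.lookup v a) (bv a)) b =
    (\<Sum>a\<in>Poly_Mapping.keys v. if a = b then Poly_Mapping.lookup v a else 0)"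
    unfolding lookup_sum by (intro sum.cong refl) (auto simp: lookup_single when_def)
  also have "\<dots> = Poly_Mapping.lookup v b"
    by (auto simp: in_keys_iff)
  finally show "Poly_Mapping.lookup v b =
      Poly_Mapping.lookup (\<Sum>a\<in>Poly_Mapping.keys v. smul (Poly_Mapping.lookup v a) (bv a)) b" by simp
qed

lemma linear_eq_linear_extension:
  fixes f :: "('a \<Rightarrow>\<^sub>0 'k::field) \<Rightarrow> ('b \<Rightarrow>\<^sub>0 'k)"
  assumes "Vector_Spaces.linear smul smul f"
  shows "f = linear_extension (\<lambda>a. f (bv a))"
proof
  fix v
  interpret Vector_Spaces.linear smul smul f by fact
  have "f v = f (\<Sum>a\<in>Poly_Mapping.keys v. smul (Poly_Mapping.lookup v a) (bv a))"
    using basis_expansion[of v] by simp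
  then show "f v = linear_extension (\<lambda>a. f (bv a)) v"
    by (simp add: linear_extension_def sum scale)
qed

lemma linear_extension_superset:
  assumes "finite S" "Poly_Mapping.keys v \<subseteq> S"
  shows "linear_extension f v = (\<Sum>a\<in>S. smul (Poly_Mapping.lookup v a) (f a))"
  unfolding linear_extension_def
  by (intro sum.mono_neutral_left assms) (auto simp: in_keys_iff)

lemma linear_linear_extension:
  fixes f :: "'a \<Rightarrow> ('b \<Rightarrow>\<^sub>0 'k::field)"
  shows "Vector_Spaces.linear smul smul (linear_extension f)"
proof
  fix v w :: "'a \<Rightarrow>\<^sub>0 'k" and r :: 'k
  have "Poly_Mapping.keys (v + w) \<subseteq> Poly_Mapping.keys v \<union> Poly_Mapping.keys w" by (rule Poly_Mapping.keys_add)
  then show "linear_extension f (v + w) = linear_extension f v + linear_extension f w"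
    by (subst (1 2 3) linear_extension_superset[where S = "Poly_Mapping.keys v \<union> Poly_Mapping.keys w"])
       (auto simp: lookup_add free_vs.scale_left_distrib sum.distrib)
  have "Poly_Mapping.keys (smul r v) \<subseteq> Poly_Mapping.keys v" by (auto simp: in_keys_iff)
  then show "linear_extension f (smul r v) = smul r (linear_extension f v)"
    by (subst (1 2) linear_extension_superset[where S = "Poly_Mapping.keys v"])
       (auto simp: free_vs.scale_sum_right)
qed

lemma linear_extension_bv [simp]: "linear_extension f (bv a) = f a"
  by (simp add: linear_extension_def)

lemma tensor_bv: "bv a \<otimes> bv b = bv (a, b)"
  by (simp add: tensor_def)

lemma bilinear_map_tensor: "bilinear_map (\<otimes>)"
  unfolding bilinear_map_def
  by (intro conjI allI; unfold_locales)
     (auto intro!: poly_mapping_eqI simp: lookup_add algebra_simps)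

lemma sweedler_tensor:
  fixes F :: "('a \<Rightarrow>\<^sub>0 'k) \<Rightarrow> ('b \<Rightarrow>\<^sub>0 'k) \<Rightarrow> ('c \<Rightarrow>\<^sub>0 'k::field)"
    and v :: "'a \<Rightarrow>\<^sub>0 'k" and w :: "'b \<Rightarrow>\<^sub>0 'k"
  assumes "bilinear_map F"
  shows "sweedler F (v \<otimes> w) = F v w"
proof -
  interpret Fl: Vector_Spaces.linear smul smul "\<lambda>x. F x y" for y
    using assms by (simp add: bilinear_map_def)
  interpret Fr: Vector_Spaces.linear smul smul "\<lambda>y. F x y" for x
    using assms by (simp add: bilinear_map_def)
  have "Poly_Mapping.keys (v \<otimes> w) \<subseteq> Poly_Mapping.keys v \<times> Poly_Mapping.keys w"
    by (auto simp: in_keys_iff)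
  then have "sweedler F (v \<otimes> w) =
      (\<Sum>(a, b)\<in>Poly_Mapping.keys v \<times> Poly_Mapping.keys w. smul (Poly_Mapping.lookup v a * Poly_Mapping.lookup w b) (F (bv a) (bv b)))"
    unfolding sweedler_def
    by (subst linear_extension_superset[where S = "Poly_Mapping.keys v \<times> Poly_Mapping.keys w"])
       (auto intro!: sum.cong)
  also have "\<dots> = (\<Sum>a\<in>Poly_Mapping.keys v. smul (Poly_Mapping.lookup v a)
      (\<Sum>b\<in>Poly_Mapping.keys w. smul (Poly_Mapping.lookup w b) (F (bv a) (bv b))))"
    by (simp add: sum.cartesian_product [symmetric] free_vs.scale_sum_right)
  also have "\<dots> = (\<Sum>a\<in>Poly_Mapping.keys v. smul (Poly_Mapping.lookup v a)
      (F (bv a) (\<Sum>b\<in>Poly_Mapping.keys w. smul (Poly_Mapping.lookup w b) (bv b))))"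
    by (simp add: Fr.sum Fr.scale)
  also have "\<dots> = F (\<Sum>a\<in>Poly_Mapping.keys v. smul (Poly_Mapping.lookup v a) (bv a)) w"
    using basis_expansion[of w] by (simp add: Fl.sum Fl.scale)
  also have "\<dots> = F v w"
    using basis_expansion[of v] by simp
  finally show ?thesis .
qed

lemma tensor_universal:
  assumes "bilinear_map F"
  shows "\<exists>!L. Vector_Spaces.linear smul smul L \<and> (\<forall>v w. L (v \<otimes> w) = F v w)"
proof (rule ex1I[of _ "sweedler F"])
  show "Vector_Spaces.linear smul smul (sweedler F) \<and> (\<forall>v w. sweedler F (v \<otimes> w) = F v w)"
    using sweedler_tensor[OF assms] by (simp add: sweedler_def linear_linear_extension)
  fix L assume L: "Vector_Spaces.linear smul smul L \<and> (\<forall>v w. L (v \<otimes> w) = F v w)"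
  then have "L (bv (a, b)) = F (bv a) (bv b)" for a b
    by (metis tensor_bv)
  then have "(\<lambda>p. L (bv p)) = (\<lambda>(a, b). F (bv a) (bv b))"
    by auto
  then show "L = sweedler F"
    using L linear_eq_linear_extension[of L] by (simp add: sweedler_def)
qed

section \<open>Hopf algebras\<close>

record (overloaded) ('a, 'k) coalgebra =
  comult :: "('a \<Rightarrow>\<^sub>0 'k::field) \<Rightarrow> (('a \<times> 'a) \<Rightarrow>\<^sub>0 'k)"
  counit :: "('a \<Rightarrow>\<^sub>0 'k::field) \<Rightarrow> 'k"

record (overloaded) ('a, 'k) hopf_algebra = "('a, 'k::field) coalgebra" +
  mult :: "('a \<Rightarrow>\<^sub>0 'k::field) \<Rightarrow> ('a \<Rightarrow>\<^sub>0 'k) \<Rightarrow> ('a \<Rightarrow>\<^sub>0 'k)"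
  unit :: "'a \<Rightarrow>\<^sub>0 'k::field"
  antipode :: "('a \<Rightarrow>\<^sub>0 'k::field) \<Rightarrow> ('a \<Rightarrow>\<^sub>0 'k)"

definition is_coalgebra :: "('a, 'k::field, 'm) coalgebra_scheme \<Rightarrow> bool" where
  "is_coalgebra C \<longleftrightarrow>
     Vector_Spaces.linear smul smul (comult C) \<and>
     Vector_Spaces.linear smul (*) (counit C) \<and>
     (\<forall>a. sweedler (\<lambda>a1 a2. sweedler (\<lambda>a11 a12. a11 \<otimes> (a12 \<otimes> a2)) (comult C a1)) (comult C a) =
          sweedler (\<lambda>a1 a2. a1 \<otimes> comult C a2) (comult C a)) \<and>
     (\<forall>a. sweedler (\<lambda>a1 a2. smul (counit C a1) a2) (comult C a) = a) \<and>
     (\<forall>a. sweedler (\<lambda>a1 a2. smul (counit C a2) a1) (comult C a) = a)"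

definition is_algebra :: "('a, 'k::field, 'm) hopf_algebra_scheme \<Rightarrow> bool" where
  "is_algebra A \<longleftrightarrow>
     bilinear_map (mult A) \<and>
     (\<forall>a b c. mult A (mult A a b) c = mult A a (mult A b c)) \<and>
     (\<forall>a. mult A (unit A) a = a \<and> mult A a (unit A) = a)"

definition is_hopf_algebra :: "('a, 'k::field, 'm) hopf_algebra_scheme \<Rightarrow> bool" where
  "is_hopf_algebra A \<longleftrightarrow>
     is_algebra A \<and> is_coalgebra A \<and>
     (\<forall>a b. comult A (mult A a b) =
        sweedler (\<lambda>a1 a2. sweedler (\<lambda>b1 b2. mult A a1 b1 \<otimes> mult A a2 b2) (comult A b)) (comult A a)) \<and>
     comult A (unit A) = unit A \<otimes> unit A \<and>
     (\<forall>a b. counit A (mult A a b) = counit A a * counit A b) \<and>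
     counit A (unit A) = 1 \<and>
     Vector_Spaces.linear smul smul (antipode A) \<and>
     (\<forall>a. sweedler (\<lambda>a1 a2. mult A (antipode A a1) a2) (comult A a) = smul (counit A a) (unit A)) \<and>
     (\<forall>a. sweedler (\<lambda>a1 a2. mult A a1 (antipode A a2)) (comult A a) = smul (counit A a) (unit A))"

definition tensor_coalgebra ::
  "('a, 'k::field, 'm) coalgebra_scheme \<Rightarrow> ('b, 'k, 'n) coalgebra_scheme \<Rightarrow> ('a \<times> 'b, 'k) coalgebra" where
  "tensor_coalgebra C D = \<lparr>
     comult = sweedler (\<lambda>x y.
       sweedler (\<lambda>x1 x2. sweedler (\<lambda>y1 y2. (x1 \<otimes> y1) \<otimes> (x2 \<otimes> y2)) (comult D y)) (comult C x)),
     counit = (\<lambda>t. \<Sum>(a, b)\<in>Poly_Mapping.keys t. Poly_Mapping.lookup t (a, b) * (counit C (bv a) * counit D (bv b))) \<rparr>"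

definition coalgebra_map ::
  "('a, 'k::field, 'm) coalgebra_scheme \<Rightarrow> ('b, 'k, 'n) coalgebra_scheme \<Rightarrow>
     (('a \<Rightarrow>\<^sub>0 'k) \<Rightarrow> ('b \<Rightarrow>\<^sub>0 'k)) \<Rightarrow> bool" where
  "coalgebra_map C D f \<longleftrightarrow>
     Vector_Spaces.linear smul smul f \<and>
     (\<forall>x. comult D (f x) = sweedler (\<lambda>x1 x2. f x1 \<otimes> f x2) (comult C x)) \<and>
     (\<forall>x. counit D (f x) = counit C x)"

definition left_module ::
  "('h, 'k::field, 'm) hopf_algebra_scheme \<Rightarrow> ((('h \<times> 'a) \<Rightarrow>\<^sub>0 'k) \<Rightarrow> ('a \<Rightarrow>\<^sub>0 'k)) \<Rightarrow> bool" where
  "left_module H r \<longleftrightarrow>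
     Vector_Spaces.linear smul smul r \<and>
     (\<forall>a. r (unit H \<otimes> a) = a) \<and>
     (\<forall>y h a. r (mult H y h \<otimes> a) = r (y \<otimes> r (h \<otimes> a)))"

definition right_module ::
  "('a, 'k::field, 'm) hopf_algebra_scheme \<Rightarrow> ((('h \<times> 'a) \<Rightarrow>\<^sub>0 'k) \<Rightarrow> ('h \<Rightarrow>\<^sub>0 'k)) \<Rightarrow> bool" where
  "right_module A l \<longleftrightarrow>
     Vector_Spaces.linear smul smul l \<and>
     (\<forall>h. l (h \<otimes> unit A) = h) \<and>
     (\<forall>h a b. l (h \<otimes> mult A a b) = l (l (h \<otimes> a) \<otimes> b))"

text \<open>
  \<open>matched_pair A H l r\<close>: here \<open>l\<close> is $\triangleleft : H \otimes A \to H$ and \<open>r\<close> is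
  $\triangleright : H \otimes A \to A$, so \<open>l (h \<otimes> a)\<close> is $h \triangleleft a$ and
  \<open>r (h \<otimes> a)\<close> is $h \triangleright a$.
\<close>

definition matched_pair ::
  "('a, 'k::field, 'm) hopf_algebra_scheme \<Rightarrow> ('h, 'k, 'n) hopf_algebra_scheme \<Rightarrow>
     ((('h \<times> 'a) \<Rightarrow>\<^sub>0 'k) \<Rightarrow> ('h \<Rightarrow>\<^sub>0 'k)) \<Rightarrow> ((('h \<times> 'a) \<Rightarrow>\<^sub>0 'k) \<Rightarrow> ('a \<Rightarrow>\<^sub>0 'k)) \<Rightarrow> bool" where
  "matched_pair A H l r \<longleftrightarrow>
     is_hopf_algebra A \<and> is_hopf_algebra H \<and>
     coalgebra_map (tensor_coalgebra H A) H l \<and>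
     coalgebra_map (tensor_coalgebra H A) A r \<and>
     left_module H r \<and> right_module A l \<and>
     (\<forall>h. r (h \<otimes> unit A) = smul (counit H h) (unit A)) \<and>
     (\<forall>a. l (unit H \<otimes> a) = smul (counit A a) (unit H)) \<and>
     (\<forall>y a b. r (y \<otimes> mult A a b) =
        sweedler (\<lambda>y1 y2. sweedler (\<lambda>a1 a2.
          mult A (r (y1 \<otimes> a1)) (r (l (y2 \<otimes> a2) \<otimes> b))) (comult A a)) (comult H y)) \<and>
     (\<forall>y h a. l (mult H y h \<otimes> a) =
        sweedler (\<lambda>h1 h2. sweedler (\<lambda>a1 a2.
          mult H (l (y \<otimes> r (h1 \<otimes> a1))) (l (h2 \<otimes> a2))) (comult A a)) (comult H h)) \<and>
     (\<forall>y a. sweedler (\<lambda>y1 y2. sweedler (\<lambda>a1 a2. l (y1 \<otimes> a1) \<otimes> r (y2 \<otimes> a2)) (comult A a)) (comult H y) =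
            sweedler (\<lambda>y1 y2. sweedler (\<lambda>a1 a2. l (y2 \<otimes> a2) \<otimes> r (y1 \<otimes> a1)) (comult A a)) (comult H y))"

section \<open>The group Hopf algebra and Sweedler's Hopf algebra\<close>

text \<open>
  Groups are types of class \<open>group_add\<close>, so the group law is written additively on the index type
  \<open>'g\<close>.  The convolution product of \<open>'g \<Rightarrow>\<^sub>0 'k\<close> from the library is then exactly the
  product of the group algebra, where the group element \<open>s\<close> appears as \<open>bv s\<close> and is multiplied:
  \<open>bv s * bv t = bv (s + t)\<close>.
\<close>

definition group_hopf_algebra :: "('g::group_add, 'k::field) hopf_algebra" where
  "group_hopf_algebra = \<lparr>
     comult = linear_extension (\<lambda>s. bv s \<otimes> bv s),
     counit = (\<lambda>v. \<Sum>s\<in>Poly_Mapping.keys v. Poly_Mapping.lookup v s),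
     mult = (*),
     unit = 1,
     antipode = linear_extension (\<lambda>s. bv (- s)) \<rparr>"

text \<open>
  Natural multiples suffice, since this is only used for finite groups.
\<close>

definition generates :: "'g::group_add \<Rightarrow> bool" where
  "generates c \<longleftrightarrow> (\<forall>s. \<exists>i::nat. s = ((+) c ^^ i) 0)"

datatype sweedler_basis = B1 | Bg | Bx | Bgx

text \<open>
  The tables are the consequences on the basis \<open>1, g, x, gx\<close> of
  $g^2 = 1$, $x^2 = 0$, $xg = -gx$ and of the given values of
  $\Delta$, $\varepsilon$, $S$ on $g$ and $x$, using that $\Delta$ and $\varepsilon$ are
  multiplicative and $S$ is antimultiplicative (e.g. $S(gx) = S(x)S(g) = -gxg = x$).
\<close>

fun sweedler_table :: "sweedler_basis \<Rightarrow> sweedler_basis \<Rightarrow> (sweedler_basis \<Rightarrow>\<^sub>0 'k::field)" where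
  "sweedler_table B1 b = bv b"
| "sweedler_table a B1 = bv a"
| "sweedler_table Bg Bg = bv B1"
| "sweedler_table Bg Bx = bv Bgx"
| "sweedler_table Bg Bgx = bv Bx"
| "sweedler_table Bx Bg = - bv Bgx"
| "sweedler_table Bx Bx = 0"
| "sweedler_table Bx Bgx = 0"
| "sweedler_table Bgx Bg = - bv Bx"
| "sweedler_table Bgx Bx = 0"
| "sweedler_table Bgx Bgx = 0"

fun sweedler_comult :: "sweedler_basis \<Rightarrow> ((sweedler_basis \<times> sweedler_basis) \<Rightarrow>\<^sub>0 'k::field)" where
  "sweedler_comult B1 = bv B1 \<otimes> bv B1"
| "sweedler_comult Bg = bv Bg \<otimes> bv Bg"
| "sweedler_comult Bx = bv Bx \<otimes> bv B1 + bv Bg \<otimes> bv Bx"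
| "sweedler_comult Bgx = bv Bgx \<otimes> bv Bg + bv B1 \<otimes> bv Bgx"

fun sweedler_antipode :: "sweedler_basis \<Rightarrow> (sweedler_basis \<Rightarrow>\<^sub>0 'k::field)" where
  "sweedler_antipode B1 = bv B1"
| "sweedler_antipode Bg = bv Bg"
| "sweedler_antipode Bx = - bv Bgx"
| "sweedler_antipode Bgx = bv Bx"

definition sweedler_hopf_algebra :: "(sweedler_basis, 'k::field) hopf_algebra" where
  "sweedler_hopf_algebra = \<lparr>
     comult = linear_extension sweedler_comult,
     counit = (\<lambda>v. Poly_Mapping.lookup v B1 + Poly_Mapping.lookup v Bg),
     mult = (\<lambda>v w. linear_extension (\<lambda>(a, b). sweedler_table a b) (v \<otimes> w)),
     unit = bv B1,
     antipode = linear_extension sweedler_antipode \<rparr>"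

end

theory Submission
  imports Defs
begin

text \<open>
  For $2 \neq 0$ in \<open>k\<close>, the classification holds for the group algebra of any group \<open>G\<close>: matched pairs of $H_4$ with
  $k[G]$ correspond to the characters $\chi : G \to k^\times$, through
  $s \triangleleft a = \varepsilon(a) s$ and $s \triangleright g = g$,
  $s \triangleright x = \chi(s) x$, $s \triangleright gx = \chi(s) gx$.  A character of a cyclic
  group of order \<open>n\<close> is determined by its value on a generator, and this value can be any
  \<open>n\<close>-th root of unity.

  That the formulas give a matched pair (\<open>matched_pair_character\<close>) is a computation.  All axioms
  are equations between multilinear maps, so they need checking on basis vectors only
  (\<open>is_hopf_algebra_on_basis\<close>, \<open>matched_pair_on_basis\<close>).

  That there are no others (\<open>matched_pair_imp_character\<close>) is seen as follows.  Each \<open>s\<close> in \<open>G\<close> is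
  group-like and invertible, so $s \triangleright -$ is a bijection that fixes \<open>1\<close> and respects the
  comultiplication.  Hence it permutes the group-like elements \<open>1, g\<close> of $H_4$ and fixes \<open>g\<close>,
  and it sends \<open>x\<close> to a skew-primitive element, $s \triangleright x = a(1-g) + bx$.  The symmetry
  axiom for \<open>s\<close> and \<open>x\<close> says
  \[ (s \triangleleft x) \otimes (1 - g) = (s - s \triangleleft g) \otimes (s \triangleright x). \]
  If $s \triangleleft g$ were not \<open>s\<close>, then $s \triangleright x$ would be a multiple of $1 - g$,
  which $s \triangleright -$ fixes, against injectivity.  So $s \triangleleft g = s$, and the left
  side gives $s \triangleleft x = 0$.  The right action is therefore trivial on every basis vector,
  so $s \triangleright -$ is multiplicative, and $x^2 = 0$ gives
  $0 = (a(1-g) + bx)^2 = 2a^2(1-g) + 2abx$.  As $2 \neq 0$, this forces \<open>a = 0\<close>, and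
  $s \mapsto b$ is a character.
\<close>

section \<open>Linear maps on free vector spaces\<close>

abbreviation lin :: "(('a \<Rightarrow>\<^sub>0 'k::field) \<Rightarrow> ('b \<Rightarrow>\<^sub>0 'k)) \<Rightarrow> bool" where
  "lin \<equiv> Vector_Spaces.linear smul smul"

lemma linI:
  assumes "\<And>v w. f (v + w) = f v + f w" "\<And>r v. f (smul r v) = smul r (f v)"
  shows "lin f"
  by unfold_locales (fact assms)+

lemma lin_add: "lin f \<Longrightarrow> f (v + w) = f v + f w"
  by (rule module_hom.add[OF Vector_Spaces.linear.axioms(3)])

lemma lin_smul: "lin f \<Longrightarrow> f (smul r v) = smul r (f v)"
  by (rule module_hom.scale[OF Vector_Spaces.linear.axioms(3)])

lemma lin_zero: "lin f \<Longrightarrow> f 0 = 0"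
  using lin_smul[of f 0 0] by simp

lemma lin_uminus: "lin f \<Longrightarrow> f (- v) = - f v"
  using lin_smul[of f "-1" v] by simp

lemma lin_diff: "lin f \<Longrightarrow> f (v - w) = f v - f w"
  using lin_add[of f v "- w"] lin_uminus[of f w] by simp

text \<open>
  The conclusions of the following extensionality principles are quantified formulas, so that
  \<open>f\<close> and \<open>g\<close> are found by higher-order pattern unification when they are applied to an axiom.
\<close>

lemma lin_ext:
  assumes "lin f" "lin g" "\<And>a. f (bv a) = g (bv a)"
  shows "\<forall>v. f v = g v"
  using linear_eq_linear_extension[OF assms(1)] linear_eq_linear_extension[OF assms(2)] assms(3)
  by simp

lemma lin_ext2:
  assumes "\<And>w. lin (\<lambda>v. f v w)" "\<And>w. lin (\<lambda>v. g v w)" "\<And>v. lin (\<lambda>w. f v w)" "\<And>v. lin (\<lambda>w. g v w)"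
    and "\<And>a b. f (bv a) (bv b) = g (bv a) (bv b)"
  shows "\<forall>v w. f v w = g v w"
  using lin_ext[OF assms(1,2)] lin_ext[OF assms(3,4)] assms(5) by blast

lemma lin_ext3:
  assumes "\<And>w u. lin (\<lambda>v. f v w u)" "\<And>w u. lin (\<lambda>v. g v w u)"
    and "\<And>v u. lin (\<lambda>w. f v w u)" "\<And>v u. lin (\<lambda>w. g v w u)"
    and "\<And>v w. lin (\<lambda>u. f v w u)" "\<And>v w. lin (\<lambda>u. g v w u)"
    and "\<And>a b c. f (bv a) (bv b) (bv c) = g (bv a) (bv b) (bv c)"
  shows "\<forall>v w u. f v w u = g v w u"
  using lin_ext[OF assms(1,2)] lin_ext2[OF assms(3-6)] assms(7) by blast

lemma lin_compose: "lin f \<Longrightarrow> lin g \<Longrightarrow> lin (\<lambda>x. f (g x))"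
  by (rule linI) (simp_all add: lin_add lin_smul)

lemma lin_linear_extension_comp: "lin g \<Longrightarrow> lin (\<lambda>x. linear_extension f (g x))"
  by (rule lin_compose[OF linear_linear_extension])

lemma lin_sweedler_arg: "lin g \<Longrightarrow> lin (\<lambda>x. sweedler F (g x))"
  unfolding sweedler_def by (rule lin_linear_extension_comp)

lemma lin_sweedler_fun: "(\<And>a b. lin (\<lambda>x. F x a b)) \<Longrightarrow> lin (\<lambda>x. sweedler (\<lambda>a b. F x a b) t)"
  unfolding sweedler_def linear_extension_def
  by (rule linI)
     (auto simp: lin_add[where f = "\<lambda>x. F x _ _"] lin_smul[where f = "\<lambda>x. F x _ _"]
         case_prod_beta sum.distrib
         free_vs.scale_sum_right free_vs.scale_right_distrib mult.commute intro!: sum.cong)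

lemma tensor_simps [simp]:
  "0 \<otimes> w = 0" "w \<otimes> 0 = 0"
  "(v + v') \<otimes> w = v \<otimes> w + v' \<otimes> w" "w \<otimes> (v + v') = w \<otimes> v + w \<otimes> v'"
  "(v - v') \<otimes> w = v \<otimes> w - v' \<otimes> w" "w \<otimes> (v - v') = w \<otimes> v - w \<otimes> v'"
  "(- v) \<otimes> w = - (v \<otimes> w)" "w \<otimes> (- v) = - (w \<otimes> v)"
  "smul r v \<otimes> w = smul r (v \<otimes> w)" "w \<otimes> smul r v = smul r (w \<otimes> v)"
  by (auto intro!: poly_mapping_eqI simp: lookup_add lookup_minus algebra_simps)

lemma lin_tensor_left: "lin g \<Longrightarrow> lin (\<lambda>x. g x \<otimes> w)"
  by (rule linI) (simp_all add: lin_add lin_smul)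
lemma lin_tensor_right: "lin g \<Longrightarrow> lin (\<lambda>x. w \<otimes> g x)"
  by (rule linI) (simp_all add: lin_add lin_smul)
lemma lin_ident: "lin (\<lambda>x. x)" by (rule linI) simp_all
lemma lin_smul_right: "lin g \<Longrightarrow> lin (\<lambda>x. smul r (g x))"
  by (rule linI) (simp_all add: lin_add lin_smul free_vs.scale_right_distrib mult.commute)

abbreviation linear_form :: "(('a \<Rightarrow>\<^sub>0 'k::field) \<Rightarrow> 'k) \<Rightarrow> bool" where
  "linear_form \<equiv> Vector_Spaces.linear smul (*)"

lemma linear_formI:
  assumes "\<And>v w. f (v + w) = f v + f w" "\<And>r v. f (smul r v) = r * f v"
  shows "linear_form f"
  by unfold_locales (auto simp: assms algebra_simps)

lemma linear_form_add: "linear_form f \<Longrightarrow> f (v + w) = f v + f w"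
  by (rule module_hom.add[OF Vector_Spaces.linear.axioms(3)])

lemma linear_form_smul: "linear_form f \<Longrightarrow> f (smul r v) = r * f v"
  by (rule module_hom.scale[OF Vector_Spaces.linear.axioms(3)])

lemma linear_form_zero: "linear_form f \<Longrightarrow> f 0 = 0"
  using linear_form_smul[of f 0 0] by simp

lemma lin_smul_left: "linear_form f \<Longrightarrow> lin (\<lambda>x. smul (f x) w)"
  by (rule linI) (simp_all add: linear_form_add linear_form_smul free_vs.scale_left_distrib)

lemma linear_form_comp: "linear_form f \<Longrightarrow> lin g \<Longrightarrow> linear_form (\<lambda>x. f (g x))"
  by (rule linear_formI) (simp_all add: linear_form_add linear_form_smul lin_add lin_smul)

text \<open>
  A linear form \<open>f\<close> turns into a linear map between free spaces as \<open>smul (f v) (bv ())\<close>, with values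
  in the space on one basis vector.
\<close>

lemma linear_form_ext:
  assumes "linear_form f" "linear_form g" "\<And>a. f (bv a) = g (bv a)"
  shows "\<forall>v. f v = g v"
proof -
  have "\<forall>v. smul (f v) (bv ()) = smul (g v) (bv ())"
    by (rule lin_ext) (auto intro: lin_smul_left assms simp: assms(3))
  then show ?thesis
    by (metis lookup_smul lookup_single_eq mult.right_neutral)
qed

lemma linear_form_ext2:
  assumes "\<And>w. linear_form (\<lambda>v. f v w)" "\<And>w. linear_form (\<lambda>v. g v w)"
    "\<And>v. linear_form (\<lambda>w. f v w)" "\<And>v. linear_form (\<lambda>w. g v w)"
    and "\<And>a b. f (bv a) (bv b) = g (bv a) (bv b)"
  shows "\<forall>v w. f v w = g v w"
  using linear_form_ext[OF assms(1,2)] linear_form_ext[OF assms(3,4)] assms(5) by blast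

lemma linear_form_mult_left: "linear_form f \<Longrightarrow> linear_form (\<lambda>x. f x * r)"
  by (rule linear_formI) (simp_all add: linear_form_add linear_form_smul algebra_simps)
lemma linear_form_mult_right: "linear_form f \<Longrightarrow> linear_form (\<lambda>x. r * f x)"
  by (rule linear_formI) (simp_all add: linear_form_add linear_form_smul algebra_simps)

lemma linear_form_keys_sum:
  fixes f :: "'a \<Rightarrow> 'k::field"
  shows "linear_form (\<lambda>v. \<Sum>a\<in>Poly_Mapping.keys v. Poly_Mapping.lookup v a * f a)"
proof (rule linear_formI)
  have superset: "(\<Sum>a\<in>Poly_Mapping.keys v. Poly_Mapping.lookup v a * f a) =
      (\<Sum>a\<in>S. Poly_Mapping.lookup v a * f a)"
    if "finite S" "Poly_Mapping.keys v \<subseteq> S" for v S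
    using that by (intro sum.mono_neutral_left) (auto simp: in_keys_iff)
  fix v w :: "'a \<Rightarrow>\<^sub>0 'k" and r
  show "(\<Sum>a\<in>Poly_Mapping.keys (v + w). Poly_Mapping.lookup (v + w) a * f a) =
    (\<Sum>a\<in>Poly_Mapping.keys v. Poly_Mapping.lookup v a * f a) + (\<Sum>a\<in>Poly_Mapping.keys w.
        Poly_Mapping.lookup w a * f a)"
    using Poly_Mapping.keys_add[of v w]
    by (subst (1 2 3) superset[where S = "Poly_Mapping.keys v \<union> Poly_Mapping.keys w"])
       (auto simp: lookup_add algebra_simps sum.distrib)
  have "Poly_Mapping.keys (smul r v) \<subseteq> Poly_Mapping.keys v" by (auto simp: in_keys_iff)
  then show "(\<Sum>a\<in>Poly_Mapping.keys (smul r v). Poly_Mapping.lookup (smul r v) a * f a) =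
    r * (\<Sum>a\<in>Poly_Mapping.keys v. Poly_Mapping.lookup v a * f a)"
    by (subst (1 2) superset[where S = "Poly_Mapping.keys v"])
       (auto simp: sum_distrib_left mult.assoc)
qed

text \<open>
  This gives the convolution product the same shape as the product of $H_4$, so that the linearity
  rules and the evaluation on basis vectors are the same for both Hopf algebras.
\<close>

lemma times_eq_linear_extension:
  fixes v w :: "'g::monoid_add \<Rightarrow>\<^sub>0 'k::field"
  shows "v * w = linear_extension (\<lambda>(s, t). bv (s + t)) (v \<otimes> w)"
proof -
  have sm: "smul r (bv s) = Poly_Mapping.single s r" for r and s :: 'g
    by (rule poly_mapping_eqI) (simp add: lookup_single when_def)
  have "Poly_Mapping.keys (v \<otimes> w) \<subseteq> Poly_Mapping.keys v \<times> Poly_Mapping.keys w"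
    by (auto simp: in_keys_iff)
  then have "linear_extension (\<lambda>(s, t). bv (s + t)) (v \<otimes> w) =
     (\<Sum>(s, t)\<in>Poly_Mapping.keys v \<times> Poly_Mapping.keys w.
        Poly_Mapping.single (s + t) (Poly_Mapping.lookup v s * Poly_Mapping.lookup w t))"
    by (subst linear_extension_superset[where S = "Poly_Mapping.keys v \<times> Poly_Mapping.keys w"])
       (auto intro!: sum.cong simp: sm)
  also have "\<dots> = (\<Sum>s\<in>Poly_Mapping.keys v. Poly_Mapping.single s (Poly_Mapping.lookup v s)) *
      (\<Sum>t\<in>Poly_Mapping.keys w. Poly_Mapping.single t (Poly_Mapping.lookup w t))"
    by (simp add: sum_product mult_single sum.cartesian_product)
  finally show ?thesis
    using basis_expansion[of v] basis_expansion[of w] by (simp add: sm)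
qed

lemmas lin_intros = lin_ident lin_smul_right lin_smul_left lin_tensor_left lin_tensor_right
  lin_sweedler_arg lin_sweedler_fun lin_linear_extension_comp linear_linear_extension

lemma sweedler_bv [simp]: "sweedler F (bv (a, b)) = F (bv a) (bv b)"
  by (simp add: sweedler_def)

lemma linear_extension_simps [simp]:
  "linear_extension f 0 = 0"
  "linear_extension f (v + w) = linear_extension f v + linear_extension f w"
  "linear_extension f (- v) = - linear_extension f v"
  "linear_extension f (v - w) = linear_extension f v - linear_extension f w"
  "linear_extension f (smul r v) = smul r (linear_extension f v)"
  by (simp_all add: linear_linear_extension lin_add lin_smul lin_uminus lin_zero lin_diff)

lemma sweedler_simps [simp]:
  "sweedler F 0 = 0"
  "sweedler F (v + w) = sweedler F v + sweedler F w"
  "sweedler F (- v) = - sweedler F v"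
  "sweedler F (v - w) = sweedler F v - sweedler F w"
  "sweedler F (smul r v) = smul r (sweedler F v)"
  by (simp_all add: sweedler_def)

declare tensor_bv [simp]

section \<open>Hopf algebras and matched pairs on a basis\<close>

text \<open>
  Both sides of every axiom are linear in each variable once the structure maps are, so each axiom
  follows from its instances at basis vectors.
\<close>

lemma is_hopf_algebra_on_basis:
  fixes A :: "('a, 'k::field) hopf_algebra"
  assumes bil: "bilinear_map (mult A)"
    and com: "lin (comult A)" and cou: "linear_form (counit A)" and ant: "lin (antipode A)"
    and "\<And>a b c. mult A (mult A (bv a) (bv b)) (bv c) = mult A (bv a) (mult A (bv b) (bv c))"
    and "\<And>a. mult A (unit A) (bv a) = bv a" "\<And>a. mult A (bv a) (unit A) = bv a"
    and "\<And>a. sweedler (\<lambda>a1 a2. sweedler (\<lambda>a11 a12. a11 \<otimes> (a12 \<otimes> a2)) (comult A a1))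
        (comult A (bv a)) =
          sweedler (\<lambda>a1 a2. a1 \<otimes> comult A a2) (comult A (bv a))"
    and "\<And>a. sweedler (\<lambda>a1 a2. smul (counit A a1) a2) (comult A (bv a)) = bv a"
    and "\<And>a. sweedler (\<lambda>a1 a2. smul (counit A a2) a1) (comult A (bv a)) = bv a"
    and "\<And>a b. comult A (mult A (bv a) (bv b)) =
        sweedler (\<lambda>a1 a2. sweedler (\<lambda>b1 b2. mult A a1 b1 \<otimes> mult A a2 b2) (comult A (bv b)))
            (comult A (bv a))"
    and "\<And>a b. counit A (mult A (bv a) (bv b)) = counit A (bv a) * counit A (bv b)"
    and "comult A (unit A) = unit A \<otimes> unit A" "counit A (unit A) = 1"
    and "\<And>a. sweedler (\<lambda>a1 a2. mult A (antipode A a1) a2) (comult A (bv a)) =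
        smul (counit A (bv a)) (unit A)"
    and "\<And>a. sweedler (\<lambda>a1 a2. mult A a1 (antipode A a2)) (comult A (bv a)) =
        smul (counit A (bv a)) (unit A)"
  shows "is_hopf_algebra A"
proof -
  have mult_right: "lin (mult A v)" and mult_left: "lin (\<lambda>v. mult A v w)" for v w
    using bil by (simp_all add: bilinear_map_def)
  note intros = lin_intros bil com cou ant lin_compose[OF com] lin_compose[OF ant]
    lin_compose[OF mult_right] lin_compose[OF mult_left] mult_left mult_right
        linear_form_comp[OF cou]
    linear_form_mult_left linear_form_mult_right
  show ?thesis
    unfolding is_hopf_algebra_def is_algebra_def is_coalgebra_def all_conj_distrib
    by (intro conjI lin_ext lin_ext2 lin_ext3 linear_form_ext2 assms) (intro intros)+
qed

lemma linear_form_tensor_counit: "linear_form (counit (tensor_coalgebra C D))"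
  using linear_form_keys_sum[of "\<lambda>(a, b). counit C (bv a) * counit D (bv b)"]
  by (simp add: tensor_coalgebra_def case_prod_beta)

lemma tensor_counit_bv [simp]:
  "counit (tensor_coalgebra C D) (bv (a, b)) = counit C (bv a) * counit D (bv b)"
  by (simp add: tensor_coalgebra_def)

lemma lin_tensor_comult: "lin (comult (tensor_coalgebra C D))"
  by (simp add: tensor_coalgebra_def) (intro lin_intros)

lemma tensor_comult_bv [simp]:
  "comult (tensor_coalgebra C D) (bv (a, b)) =
     sweedler (\<lambda>x1 x2. sweedler (\<lambda>y1 y2. (x1 \<otimes> y1) \<otimes> (x2 \<otimes> y2)) (comult D (bv b)))
         (comult C (bv a))"
  by (simp add: tensor_coalgebra_def del: tensor_bv)

lemma coalgebra_map_on_basis: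
  assumes "lin (comult D)" "linear_form (counit D)" "lin (comult C)" "linear_form (counit C)"
      "lin f"
    and "\<And>a. comult D (f (bv a)) = sweedler (\<lambda>x1 x2. f x1 \<otimes> f x2) (comult C (bv a))"
    and "\<And>a. counit D (f (bv a)) = counit C (bv a)"
  shows "coalgebra_map C D f"
  unfolding coalgebra_map_def
  by (intro conjI lin_ext linear_form_ext assms)
     (intro lin_intros lin_compose[OF assms(1)] linear_form_comp[OF assms(2)] assms)+

lemma matched_pair_on_basis:
  fixes A :: "('a, 'k::field) hopf_algebra" and H :: "('h, 'k) hopf_algebra"
  assumes hopf: "is_hopf_algebra A" "is_hopf_algebra H" and l: "lin l" and r: "lin r"
    and "\<And>h a. comult H (l (bv (h, a))) = sweedler (\<lambda>x1 x2. l x1 \<otimes> l x2)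
        (comult (tensor_coalgebra H A) (bv (h, a)))"
    and "\<And>h a. counit H (l (bv (h, a))) = counit H (bv h) * counit A (bv a)"
    and "\<And>h a. comult A (r (bv (h, a))) = sweedler (\<lambda>x1 x2. r x1 \<otimes> r x2)
        (comult (tensor_coalgebra H A) (bv (h, a)))"
    and "\<And>h a. counit A (r (bv (h, a))) = counit H (bv h) * counit A (bv a)"
    and "\<And>a. r (unit H \<otimes> bv a) = bv a"
    and "\<And>y h a. r (mult H (bv y) (bv h) \<otimes> bv a) = r (bv y \<otimes> r (bv h \<otimes> bv a))"
    and "\<And>h. l (bv h \<otimes> unit A) = bv h"
    and "\<And>h a b. l (bv h \<otimes> mult A (bv a) (bv b)) = l (l (bv h \<otimes> bv a) \<otimes> bv b)"
    and "\<And>h. r (bv h \<otimes> unit A) = smul (counit H (bv h)) (unit A)"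
    and "\<And>a. l (unit H \<otimes> bv a) = smul (counit A (bv a)) (unit H)"
    and "\<And>y a b. r (bv y \<otimes> mult A (bv a) (bv b)) =
        sweedler (\<lambda>y1 y2. sweedler (\<lambda>a1 a2.
          mult A (r (y1 \<otimes> a1)) (r (l (y2 \<otimes> a2) \<otimes> bv b))) (comult A (bv a))) (comult H (bv y))"
    and "\<And>y h a. l (mult H (bv y) (bv h) \<otimes> bv a) =
        sweedler (\<lambda>h1 h2. sweedler (\<lambda>a1 a2.
          mult H (l (bv y \<otimes> r (h1 \<otimes> a1))) (l (h2 \<otimes> a2))) (comult A (bv a))) (comult H (bv h))"
    and "\<And>y a. sweedler (\<lambda>y1 y2. sweedler (\<lambda>a1 a2. l (y1 \<otimes> a1) \<otimes> r (y2 \<otimes> a2)) (comult A (bv a)))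
        (comult H (bv y)) =
            sweedler (\<lambda>y1 y2. sweedler (\<lambda>a1 a2. l (y2 \<otimes> a2) \<otimes> r (y1 \<otimes> a1)) (comult A (bv a)))
                (comult H (bv y))"
  shows "matched_pair A H l r"
proof -
  have mult: "lin (mult A v)" "lin (\<lambda>v. mult A v w)" "lin (mult H v')" "lin (\<lambda>v. mult H v w')"
    and lin: "lin (comult A)" "lin (comult H)" "linear_form (counit A)" "linear_form (counit H)"
    for v w v' w'
    using hopf by (simp_all add: is_hopf_algebra_def is_algebra_def is_coalgebra_def
        bilinear_map_def)
  note intros = lin_intros lin l r mult lin_compose[OF lin(1)] lin_compose[OF lin(2)]
      lin_compose[OF l] lin_compose[OF r]
    lin_compose[OF mult(1)] lin_compose[OF mult(2)] lin_compose[OF mult(3)] lin_compose[OF mult(4)]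
  have maps: "coalgebra_map (tensor_coalgebra H A) H l" "coalgebra_map (tensor_coalgebra H A) A r"
    by (rule coalgebra_map_on_basis; use assms in \<open>force simp: lin lin_tensor_comult
        linear_form_tensor_counit\<close>)+
  show ?thesis
    unfolding matched_pair_def left_module_def right_module_def
    by (intro conjI lin_ext lin_ext2 lin_ext3 maps assms) (intro intros)+
qed

section \<open>The group algebra and Sweedler's algebra are Hopf algebras\<close>

text \<open>
  The unit is written as the basis vector at \<open>0\<close>.  The simplification rule \<open>single_one\<close> would
  turn it into \<open>1\<close>, to which the evaluation rules for basis vectors do not apply, and is therefore disabled
  where this unit is evaluated.
\<close>

lemma group_simps [simp]:
  "comult group_hopf_algebra = linear_extension (\<lambda>s. bv s \<otimes> bv s)"
  "mult group_hopf_algebra = (\<lambda>v w. linear_extension (\<lambda>(s, t). bv (s + t)) (v \<otimes> w))"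
  "unit group_hopf_algebra = bv 0"
  "antipode group_hopf_algebra = linear_extension (\<lambda>s. bv (- s))"
  by (simp_all add: group_hopf_algebra_def times_eq_linear_extension [abs_def])

lemma linear_form_group_counit: "linear_form (counit group_hopf_algebra)"
  using linear_form_keys_sum[of "\<lambda>_. 1"] by (simp add: group_hopf_algebra_def)

lemma group_counit_bv [simp]: "counit group_hopf_algebra (bv s) = 1"
  by (simp add: group_hopf_algebra_def)

lemma sweedler_algebra_simps [simp]:
  "comult sweedler_hopf_algebra = linear_extension sweedler_comult"
  "mult sweedler_hopf_algebra = (\<lambda>v w. linear_extension (\<lambda>(a, b). sweedler_table a b) (v \<otimes> w))"
  "unit sweedler_hopf_algebra = bv B1"
  "antipode sweedler_hopf_algebra = linear_extension sweedler_antipode"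
  "counit sweedler_hopf_algebra v = Poly_Mapping.lookup v B1 + Poly_Mapping.lookup v Bg"
  by (simp_all add: sweedler_hopf_algebra_def)

lemma linear_form_sweedler_counit: "linear_form (counit sweedler_hopf_algebra)"
  by (rule linear_formI) (simp_all add: lookup_add algebra_simps)

lemma is_hopf_algebra_group:
  "is_hopf_algebra (group_hopf_algebra :: ('g::group_add, 'k::field) hopf_algebra)"
  by (rule is_hopf_algebra_on_basis)
     (auto simp: bilinear_map_def add.assoc linear_form_group_counit simp del: single_one
         intro!: lin_intros)

lemma is_hopf_algebra_sweedler:
  "is_hopf_algebra (sweedler_hopf_algebra :: (sweedler_basis, 'k::field) hopf_algebra)"
proof (rule is_hopf_algebra_on_basis)
  show "bilinear_map (mult (sweedler_hopf_algebra :: (sweedler_basis, 'k) hopf_algebra))"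
    by (auto simp: bilinear_map_def intro!: lin_intros)
  show "lin (comult (sweedler_hopf_algebra :: (sweedler_basis, 'k) hopf_algebra))"
    "lin (antipode (sweedler_hopf_algebra :: (sweedler_basis, 'k) hopf_algebra))"
    by (auto intro: lin_intros)
  show "linear_form (counit (sweedler_hopf_algebra :: (sweedler_basis, 'k) hopf_algebra))"
    by (rule linear_form_sweedler_counit)
next
  fix a b c
  let ?A = "sweedler_hopf_algebra :: (sweedler_basis, 'k) hopf_algebra"
  show "mult ?A (mult ?A (bv a) (bv b)) (bv c) = mult ?A (bv a) (mult ?A (bv b) (bv c))"
    by (cases a; cases b; cases c; simp)
  show "comult ?A (mult ?A (bv a) (bv b)) =
        sweedler (\<lambda>a1 a2. sweedler (\<lambda>b1 b2. mult ?A a1 b1 \<otimes> mult ?A a2 b2) (comult ?A (bv b)))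
            (comult ?A (bv a))"
    by (cases a; cases b; simp)
  show "counit ?A (mult ?A (bv a) (bv b)) = counit ?A (bv a) * counit ?A (bv b)"
    by (cases a; cases b; simp add: lookup_single)
next
  fix a
  let ?A = "sweedler_hopf_algebra :: (sweedler_basis, 'k) hopf_algebra"
  show "mult ?A (unit ?A) (bv a) = bv a" "mult ?A (bv a) (unit ?A) = bv a"
    by (cases a; simp)+
  show "sweedler (\<lambda>a1 a2. sweedler (\<lambda>a11 a12. a11 \<otimes> (a12 \<otimes> a2)) (comult ?A a1)) (comult ?A (bv a)) =
          sweedler (\<lambda>a1 a2. a1 \<otimes> comult ?A a2) (comult ?A (bv a))"
    by (cases a; simp add: algebra_simps)
  show "sweedler (\<lambda>a1 a2. smul (counit ?A a1) a2) (comult ?A (bv a)) = bv a"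
    "sweedler (\<lambda>a1 a2. smul (counit ?A a2) a1) (comult ?A (bv a)) = bv a"
    "sweedler (\<lambda>a1 a2. mult ?A (antipode ?A a1) a2) (comult ?A (bv a)) =
        smul (counit ?A (bv a)) (unit ?A)"
    "sweedler (\<lambda>a1 a2. mult ?A a1 (antipode ?A a2)) (comult ?A (bv a)) =
        smul (counit ?A (bv a)) (unit ?A)"
    by (cases a; simp add: lookup_single)+
qed (simp_all add: lookup_single)

section \<open>The matched pair of a character\<close>

definition is_character :: "('g::group_add \<Rightarrow> 'k::field) \<Rightarrow> bool" where
  "is_character \<chi> \<longleftrightarrow> \<chi> 0 = 1 \<and> (\<forall>s t. \<chi> (s + t) = \<chi> s * \<chi> t)"

definition trivial_action :: "(('g \<times> sweedler_basis) \<Rightarrow>\<^sub>0 'k::field) \<Rightarrow> ('g \<Rightarrow>\<^sub>0 'k)" where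
  "trivial_action = linear_extension (\<lambda>(s, a). smul (counit sweedler_hopf_algebra (bv a)) (bv s))"

text \<open>
  $H_4$ is graded by the degree in \<open>x\<close>, as its relations and its comultiplication are homogeneous.
  Hence multiplying the part of degree \<open>d\<close> by the \<open>d\<close>-th power of a nonzero scalar is a Hopf algebra
  automorphism.
\<close>

fun x_degree :: "sweedler_basis \<Rightarrow> nat" where
  "x_degree B1 = 0" | "x_degree Bg = 0" | "x_degree Bx = 1" | "x_degree Bgx = 1"

definition character_action ::
    "('g \<Rightarrow> 'k) \<Rightarrow> (('g \<times> sweedler_basis) \<Rightarrow>\<^sub>0 'k::field) \<Rightarrow> (sweedler_basis \<Rightarrow>\<^sub>0 'k)" where
  "character_action \<chi> = linear_extension (\<lambda>(s, a). smul (\<chi> s ^ x_degree a) (bv a))"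

text \<open>
  As the right action is trivial, the axioms reduce to saying that \<open>G\<close> acts on $H_4$ by Hopf
  algebra automorphisms; this is the grading above combined with the multiplicativity of
  \<open>\<chi>\<close>.  In the symmetry axiom both sides are $s \otimes (s \triangleright a)$.
\<close>

lemma matched_pair_character:
  fixes \<chi> :: "'g::group_add \<Rightarrow> 'k::field"
  assumes "is_character \<chi>"
  shows "matched_pair sweedler_hopf_algebra group_hopf_algebra trivial_action (character_action \<chi>)"
proof -
  let ?A = "sweedler_hopf_algebra :: (sweedler_basis, 'k) hopf_algebra"
  let ?H = "group_hopf_algebra :: ('g, 'k) hopf_algebra"
  let ?l = "trivial_action :: ('g \<times> sweedler_basis \<Rightarrow>\<^sub>0 'k) \<Rightarrow> _" and ?r = "character_action \<chi>"
  have [simp]: "\<chi> 0 = 1" "\<chi> (s + t) = \<chi> s * \<chi> t" for s t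
    using assms by (simp_all add: is_character_def)
  note defs = trivial_action_def character_action_def lookup_single
  show ?thesis
  proof (rule matched_pair_on_basis)
    fix s t :: 'g and a b
    show "comult ?H (?l (bv (s, a))) = sweedler (\<lambda>x1 x2. ?l x1 \<otimes> ?l x2)
        (comult (tensor_coalgebra ?H ?A) (bv (s, a)))"
      by (cases a; simp add: defs)
    show "counit ?H (?l (bv (s, a))) = counit ?H (bv s) * counit ?A (bv a)"
      by (cases a; simp add: defs linear_form_smul[OF linear_form_group_counit]
          linear_form_zero[OF linear_form_group_counit])
    show "comult ?A (?r (bv (s, a))) = sweedler (\<lambda>x1 x2. ?r x1 \<otimes> ?r x2)
        (comult (tensor_coalgebra ?H ?A) (bv (s, a)))"
      by (cases a; simp add: defs free_vs.scale_right_distrib)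
    show "counit ?A (?r (bv (s, a))) = counit ?H (bv s) * counit ?A (bv a)"
      by (cases a; simp add: defs)
    show "?r (unit ?H \<otimes> bv a) = bv a"
      by (simp add: defs del: single_one)
    show "?r (mult ?H (bv s) (bv t) \<otimes> bv a) = ?r (bv s \<otimes> ?r (bv t \<otimes> bv a))"
      by (cases a; simp add: defs mult.commute)
    show "?l (bv s \<otimes> unit ?A) = bv s"
      by (simp add: defs)
    show "?l (bv s \<otimes> mult ?A (bv a) (bv b)) = ?l (?l (bv s \<otimes> bv a) \<otimes> bv b)"
      by (cases a; cases b; simp add: defs)
    show "?r (bv s \<otimes> unit ?A) = smul (counit ?H (bv s)) (unit ?A)"
      by (simp add: defs)
    show "?l (unit ?H \<otimes> bv a) = smul (counit ?A (bv a)) (unit ?H)"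
      by (simp add: defs del: single_one)
    show "?r (bv s \<otimes> mult ?A (bv a) (bv b)) =
        sweedler (\<lambda>y1 y2. sweedler (\<lambda>a1 a2.
          mult ?A (?r (y1 \<otimes> a1)) (?r (?l (y2 \<otimes> a2) \<otimes> bv b))) (comult ?A (bv a))) (comult ?H (bv s))"
      by (cases a; cases b; simp add: defs)
    show "?l (mult ?H (bv s) (bv t) \<otimes> bv a) =
        sweedler (\<lambda>h1 h2. sweedler (\<lambda>a1 a2.
          mult ?H (?l (bv s \<otimes> ?r (h1 \<otimes> a1))) (?l (h2 \<otimes> a2))) (comult ?A (bv a))) (comult ?H (bv t))"
      by (cases a; simp add: defs)
    show "sweedler (\<lambda>y1 y2. sweedler (\<lambda>a1 a2. ?l (y1 \<otimes> a1) \<otimes> ?r (y2 \<otimes> a2)) (comult ?A (bv a)))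
        (comult ?H (bv s)) =
          sweedler (\<lambda>y1 y2. sweedler (\<lambda>a1 a2. ?l (y2 \<otimes> a2) \<otimes> ?r (y1 \<otimes> a1)) (comult ?A (bv a)))
              (comult ?H (bv s))"
      by (cases a; simp add: defs)
  qed (simp_all add: is_hopf_algebra_sweedler is_hopf_algebra_group trivial_action_def
      character_action_def
        linear_linear_extension)
qed

section \<open>Group-like and skew-primitive elements of Sweedler's algebra\<close>

lemma UNIV_sweedler_basis: "UNIV = {B1, Bg, Bx, Bgx}"
  using sweedler_basis.exhaust by auto

lemma linear_extension_sweedler_basis:
  "linear_extension f v =
     smul (Poly_Mapping.lookup v B1) (f B1) + smul (Poly_Mapping.lookup v Bg) (f Bg) +
     smul (Poly_Mapping.lookup v Bx) (f Bx) + smul (Poly_Mapping.lookup v Bgx) (f Bgx)"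
proof -
  have "Poly_Mapping.keys v \<subseteq> {B1, Bg, Bx, Bgx}"
    using UNIV_sweedler_basis by blast
  then show ?thesis
    using linear_extension_superset[of "{B1, Bg, Bx, Bgx}" v f] by (simp add: add.assoc)
qed

lemma sweedler_eqI:
  assumes "Poly_Mapping.lookup v B1 = Poly_Mapping.lookup w B1"
    "Poly_Mapping.lookup v Bg = Poly_Mapping.lookup w Bg"
    "Poly_Mapping.lookup v Bx = Poly_Mapping.lookup w Bx"
    "Poly_Mapping.lookup v Bgx = Poly_Mapping.lookup w Bgx"
  shows "v = w"
  by (rule poly_mapping_eqI, case_tac k) (simp_all add: assms)

text \<open>
  For $v = a + bg + cx + d\,gx$, the coefficients of $x \otimes x$, $gx \otimes gx$ and
  $1 \otimes g$ are zero in $\Delta(v)$ and are $c^2$, $d^2$ and $ab$ in $v \otimes v$.  With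
  $a + b = \varepsilon(v) = 1$, only \<open>1\<close> and \<open>g\<close> remain.
\<close>

lemma sweedler_grouplike:
  fixes v :: "sweedler_basis \<Rightarrow>\<^sub>0 'k::field"
  assumes "comult sweedler_hopf_algebra v = v \<otimes> v" "counit sweedler_hopf_algebra v = 1"
  shows "v = bv B1 \<or> v = bv Bg"
proof -
  have "Poly_Mapping.lookup (linear_extension sweedler_comult v) p =
      Poly_Mapping.lookup (v \<otimes> v) p" for p
    using assms(1) by simp
  note eqs = this[unfolded linear_extension_sweedler_basis]
  have "Poly_Mapping.lookup v Bx = 0" "Poly_Mapping.lookup v Bgx = 0"
    "Poly_Mapping.lookup v B1 * Poly_Mapping.lookup v Bg = 0"
    using eqs[of "(Bx, Bx)"] eqs[of "(Bgx, Bgx)"] eqs[of "(B1, Bg)"]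
    by (simp_all add: lookup_add lookup_single)
  with assms(2) show ?thesis
    by (auto intro!: sweedler_eqI simp: lookup_single)
qed

text \<open>
  For $v = a + bg + cx + d\,gx$, comparing the coefficients of $g \otimes 1$ gives $a + b = 0$, and
  those of $gx \otimes 1$ give $d = 0$.
\<close>

lemma sweedler_skew_primitive:
  fixes v :: "sweedler_basis \<Rightarrow>\<^sub>0 'k::field"
  assumes "comult sweedler_hopf_algebra v = v \<otimes> bv B1 + bv Bg \<otimes> v"
  shows "\<exists>a b. v = smul a (bv B1 - bv Bg) + smul b (bv Bx)"
proof -
  have "Poly_Mapping.lookup (linear_extension sweedler_comult v) p =
      Poly_Mapping.lookup (v \<otimes> bv B1 + bv Bg \<otimes> v) p" for p
    using assms by simp
  note eqs = this[unfolded linear_extension_sweedler_basis]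
  have "Poly_Mapping.lookup v Bgx = 0" "Poly_Mapping.lookup v Bg = - Poly_Mapping.lookup v B1"
    using eqs[of "(Bgx, B1)"] eqs[of "(Bg, B1)"]
    by (simp_all add: lookup_add lookup_single eq_neg_iff_add_eq_0)
  then have "v = smul (Poly_Mapping.lookup v B1) (bv B1 - bv Bg) +
      smul (Poly_Mapping.lookup v Bx) (bv Bx)"
    by (intro sweedler_eqI) (simp_all add: lookup_add lookup_minus lookup_single)
  then show ?thesis by blast
qed

section \<open>Every matched pair comes from a character\<close>

text \<open>
  The symmetry axiom equates two pure tensors.  This lemma and the next extract from it that
  $s \triangleright x$ is a multiple of $1 - g$ unless $s \triangleleft g = s$, and that
  $s \triangleleft x = 0$ if $s \triangleleft g = s$.
\<close>

lemma tensor_eq_imp_smul: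
  assumes "v \<otimes> w = v' \<otimes> w'" "v' \<noteq> 0"
  shows "\<exists>q. w' = smul q w"
proof -
  from assms(2) obtain a where a: "Poly_Mapping.lookup v' a \<noteq> 0"
    by (metis lookup_zero poly_mapping_eqI)
  have "Poly_Mapping.lookup v a * Poly_Mapping.lookup w b =
      Poly_Mapping.lookup v' a * Poly_Mapping.lookup w' b" for b
    using arg_cong[OF assms(1), of "\<lambda>t. Poly_Mapping.lookup t (a, b)"] by simp
  then have "w' = smul (Poly_Mapping.lookup v a / Poly_Mapping.lookup v' a) w"
    using a by (intro poly_mapping_eqI) (simp add: field_simps)
  then show ?thesis by blast
qed

lemma tensor_eq_0_imp:
  assumes "v \<otimes> w = 0" "w \<noteq> 0"
  shows "v = 0"
proof -
  from assms(2) obtain b where b: "Poly_Mapping.lookup w b \<noteq> 0"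
    by (metis lookup_zero poly_mapping_eqI)
  have "Poly_Mapping.lookup v a * Poly_Mapping.lookup w b = 0" for a
    using arg_cong[OF assms(1), of "\<lambda>t. Poly_Mapping.lookup t (a, b)"] by simp
  with b show ?thesis by (intro poly_mapping_eqI) simp
qed

lemma two_neq_zero:
  assumes "CHAR('k::field) \<noteq> 2"
  shows "(2 :: 'k) \<noteq> 0"
proof
  assume "(2 :: 'k) = 0"
  then have "CHAR('k) dvd 2"
    using of_nat_eq_0_iff_char_dvd[where 'a = 'k, of 2] by simp
  then have "CHAR('k) = 1 \<or> CHAR('k) = 2"
    using dvd_imp_le[of "CHAR('k)" 2] by (cases "CHAR('k)") auto
  then show False
    using assms CHAR_not_1[where 'a = 'k] by simp
qed

text \<open>
  The two actions are determined in turn.  The values of the left action on \<open>1\<close> and \<open>g\<close> make the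
  symmetry axiom at \<open>x\<close> an equation between pure tensors, which shows the right action to be
  trivial.  Only then is the left action known to be multiplicative, so that $x^2 = 0$
  can be used to determine it on \<open>x\<close>.
\<close>

lemma matched_pair_imp_character:
  fixes l :: "(('g::group_add \<times> sweedler_basis) \<Rightarrow>\<^sub>0 'k::field) \<Rightarrow> ('g \<Rightarrow>\<^sub>0 'k)"
  assumes char: "CHAR('k) \<noteq> 2"
    and mp: "matched_pair sweedler_hopf_algebra group_hopf_algebra l r"
  obtains \<chi> where "is_character \<chi>" "l = trivial_action" "r = character_action \<chi>"
proof -
  let ?A = "sweedler_hopf_algebra :: (sweedler_basis, 'k) hopf_algebra"
  let ?H = "group_hopf_algebra :: ('g, 'k) hopf_algebra"
  have l: "lin l" and r: "lin r"
    using mp by (simp_all add: matched_pair_def coalgebra_map_def)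
  note lin_r = lin_add[OF r] lin_smul[OF r] lin_uminus[OF r] lin_diff[OF r] lin_zero[OF r]
  have r_one: "r (bv (s, B1)) = bv B1" and l_one: "l (bv (s, B1)) = bv s" for s
  proof -
    have "r (bv s \<otimes> unit ?A) = smul (counit ?H (bv s)) (unit ?A)" "l (bv s \<otimes> unit ?A) = bv s"
      using mp unfolding matched_pair_def right_module_def by blast+
    then show "r (bv (s, B1)) = bv B1" "l (bv (s, B1)) = bv s" by simp_all
  qed
  have r_zero: "r (bv 0 \<otimes> v) = v" and r_comp: "r (bv s \<otimes> r (bv t \<otimes> v)) = r (bv (s + t) \<otimes> v)"
      for s t v
  proof -
    have "r (unit ?H \<otimes> v) = v" "r (mult ?H (bv s) (bv t) \<otimes> v) = r (bv s \<otimes> r (bv t \<otimes> v))"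
      using mp unfolding matched_pair_def left_module_def by blast+
    then show "r (bv 0 \<otimes> v) = v" "r (bv s \<otimes> r (bv t \<otimes> v)) = r (bv (s + t) \<otimes> v)"
      by simp_all
  qed
  have r_inverse: "r (bv (- s) \<otimes> r (bv s \<otimes> v)) = v" for s v
    using r_comp[of "- s" s v] r_zero[of v] by simp
  have r_comult: "comult ?A (r (bv (s, a))) = sweedler (\<lambda>x1 x2. r x1 \<otimes> r x2)
      (comult (tensor_coalgebra ?H ?A) (bv (s, a)))"
    and r_counit: "counit ?A (r (bv (s, a))) = counit ?H (bv s) * counit ?A (bv a)" for s a
    using mp unfolding matched_pair_def coalgebra_map_def by (metis, metis tensor_counit_bv)
  have r_g: "r (bv (s, Bg)) = bv Bg" for s
  proof -
    have "r (bv (s, Bg)) = bv B1 \<or> r (bv (s, Bg)) = bv Bg"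
      using r_comult[of s Bg] r_counit[of s Bg]
      by (intro sweedler_grouplike) (simp_all add: lookup_single)
    moreover have "r (bv (s, Bg)) \<noteq> bv B1"
    proof
      assume "r (bv (s, Bg)) = bv B1"
      then have "bv Bg = (bv B1 :: sweedler_basis \<Rightarrow>\<^sub>0 'k)"
        using r_inverse[of s "bv Bg"] by (simp add: r_one)
      from arg_cong[OF this, of "\<lambda>v. Poly_Mapping.lookup v Bg"] show False
          by (simp add: lookup_single)
    qed
    ultimately show ?thesis by blast
  qed
  have r_x_skew: "\<exists>a b. r (bv (s, Bx)) = smul a (bv B1 - bv Bg) + smul b (bv Bx)" for s
    using r_comult[of s Bx]
    by (intro sweedler_skew_primitive) (simp add: r_one r_g)
  have compat: "l (bv (s, Bx)) \<otimes> (bv B1 - bv Bg) = (bv s - l (bv (s, Bg))) \<otimes> r (bv (s, Bx))" for s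
  proof -
    have "sweedler (\<lambda>y1 y2. sweedler (\<lambda>a1 a2. l (y1 \<otimes> a1) \<otimes> r (y2 \<otimes> a2)) (comult ?A (bv Bx)))
        (comult ?H (bv s)) =
            sweedler (\<lambda>y1 y2. sweedler (\<lambda>a1 a2. l (y2 \<otimes> a2) \<otimes> r (y1 \<otimes> a1)) (comult ?A (bv Bx)))
                (comult ?H (bv s))"
      using mp unfolding matched_pair_def by blast
    then show ?thesis
      by (simp add: r_one r_g l_one algebra_simps)
  qed
  have l_g: "l (bv (s, Bg)) = bv s" for s
  proof (rule ccontr)
    assume "l (bv (s, Bg)) \<noteq> bv s"
    then obtain q where q: "r (bv (s, Bx)) = smul q (bv B1 - bv Bg)"
      using tensor_eq_imp_smul[OF compat[of s]] by auto
    have "bv Bx = r (bv (- s) \<otimes> r (bv s \<otimes> bv Bx))"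
      by (rule r_inverse[symmetric])
    also have "\<dots> = smul q (bv B1 - bv Bg)"
      by (simp add: q lin_r r_one r_g)
    finally have "bv Bx = smul q (bv B1 - bv Bg)" .
    from arg_cong[OF this, of "\<lambda>v. Poly_Mapping.lookup v Bx"] show False
      by (simp add: lookup_single lookup_minus)
  qed
  have l_x: "l (bv (s, Bx)) = 0" for s
  proof (rule tensor_eq_0_imp)
    show "l (bv (s, Bx)) \<otimes> (bv B1 - bv Bg) = 0"
      using compat[of s] by (simp add: l_g)
    show "bv B1 - bv Bg \<noteq> (0 :: sweedler_basis \<Rightarrow>\<^sub>0 'k)"
    proof
      assume "bv B1 - bv Bg = (0 :: sweedler_basis \<Rightarrow>\<^sub>0 'k)"
      from arg_cong[OF this, of "\<lambda>v. Poly_Mapping.lookup v B1"] show False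
        by (simp add: lookup_minus lookup_single)
    qed
  qed
  have l_gx: "l (bv (s, Bgx)) = 0" for s
  proof -
    have "l (bv s \<otimes> mult ?A (bv Bg) (bv Bx)) = l (l (bv s \<otimes> bv Bg) \<otimes> bv Bx)"
      using mp unfolding matched_pair_def right_module_def by blast
    then show ?thesis by (simp add: l_g l_x)
  qed
  have r_mult: "r (bv s \<otimes> mult ?A (bv a) (bv b)) =
        sweedler (\<lambda>y1 y2. sweedler (\<lambda>a1 a2.
          mult ?A (r (y1 \<otimes> a1)) (r (l (y2 \<otimes> a2) \<otimes> bv b))) (comult ?A (bv a)))
              (comult ?H (bv s))" for s a b
    using mp unfolding matched_pair_def by blast
  define \<chi> where "\<chi> s = Poly_Mapping.lookup (r (bv (s, Bx))) Bx" for s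
  have r_x: "r (bv (s, Bx)) = smul (\<chi> s) (bv Bx)" for s
  proof -
    obtain a b where ab: "r (bv (s, Bx)) = smul a (bv B1 - bv Bg) + smul b (bv Bx)"
      using r_x_skew by blast
    have "mult ?A (r (bv (s, Bx))) (r (bv (s, Bx))) = 0"
      \<comment> \<open>The product $x \cdot x$ is zero; the term with $s \triangleleft x$ drops out.\<close>
      using r_mult[of s Bx Bx] by (simp add: l_one l_x lin_r)
    \<comment> \<open>$(1 - g)^2 = 2(1 - g)$ has the coefficient \<open>2\<close> at \<open>1\<close>, where the mixed terms in \<open>x\<close> do
        not contribute.\<close>
    from arg_cong[OF this, of "\<lambda>v. Poly_Mapping.lookup v B1"] have "2 * (a * a) = 0"
      by (simp add: ab lookup_add lookup_minus lookup_single algebra_simps)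
    then have "a = 0"
      using two_neq_zero[OF char] by simp
    then show ?thesis
      by (simp add: \<chi>_def ab lookup_single)
  qed
  have r_gx: "r (bv (s, Bgx)) = smul (\<chi> s) (bv Bgx)" for s
    using r_mult[of s Bg Bx] by (simp add: l_g r_g r_x)
  have "is_character \<chi>"
    unfolding is_character_def
  proof (intro conjI allI)
    show "\<chi> 0 = 1"
      using r_zero[of "bv Bx"] by (simp add: \<chi>_def lookup_single del: single_one)
    show "\<chi> (s + t) = \<chi> s * \<chi> t" for s t
      using r_comp[of s t "bv Bx"] unfolding \<chi>_def[of "s + t"]
      by (metis (no_types, lifting) tensor_bv lookup_smul lookup_single_eq mult.commute
          mult.right_neutral
          r_x tensor_simps(10) lin_smul[OF r])
  qed
  moreover have "\<forall>v. l v = trivial_action v"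
  proof (rule lin_ext)
    show "l (bv p) = trivial_action (bv p)" for p
      by (cases p; cases "snd p") (simp_all add: trivial_action_def lookup_single l_one l_g l_x
          l_gx)
  qed (simp_all add: l trivial_action_def linear_linear_extension)
  moreover have "\<forall>v. r v = character_action \<chi> v"
  proof (rule lin_ext)
    show "r (bv p) = character_action \<chi> (bv p)" for p
      by (cases p; cases "snd p") (simp_all add: character_action_def r_one r_g r_x r_gx)
  qed (simp_all add: r character_action_def linear_linear_extension)
  ultimately show ?thesis using that by (simp add: fun_eq_iff)
qed

section \<open>Characters of a finite cyclic group\<close>

abbreviation nat_multiple :: "nat \<Rightarrow> 'g::group_add \<Rightarrow> 'g" where
  "nat_multiple i c \<equiv> ((+) c ^^ i) 0"

lemma nat_multiple_add: "nat_multiple (i + j) c = nat_multiple i c + nat_multiple j c"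
  by (induction i) (simp_all add: add.assoc)

lemma nat_multiple_diff:
  assumes "i \<le> j" "nat_multiple i c = nat_multiple j c"
  shows "nat_multiple (j - i) c = 0"
  using nat_multiple_add[of i "j - i" c] assms
  by (metis add.right_neutral add_left_cancel le_add_diff_inverse)

lemma bv_power: "bv c ^ i = (bv (nat_multiple i c) :: 'g::group_add \<Rightarrow>\<^sub>0 'k::field)"
  by (induction i) (simp_all add: mult_single)

lemma nat_multiple_mult_eq_0: "nat_multiple m c = 0 \<Longrightarrow> nat_multiple (m * q) c = 0"
  by (induction q) (simp_all add: nat_multiple_add)

lemma nat_multiple_mod:
  assumes "nat_multiple m c = 0"
  shows "nat_multiple i c = nat_multiple (i mod m) c"
  using assms by (rule funpow_mod_eq[symmetric])

text \<open>
  If a multiple \<open>m > 0\<close> of \<open>c\<close> vanishes, then the first \<open>m\<close> multiples of \<open>c\<close> exhaust the group, so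
  \<open>n \<le> m\<close>.  Hence the first \<open>n\<close> multiples are distinct and also exhaust the group.  The multiple
  \<open>n\<close> of \<open>c\<close> is one of them, and it can only be the zeroth.
\<close>

lemma nat_multiple_eq_0_iff:
  fixes c :: "'c::group_add"
  assumes "CARD('c) = n" "n > 0" "generates c"
  shows "nat_multiple i c = 0 \<longleftrightarrow> n dvd i"
proof -
  have no_smaller: "n \<le> m" if "m > 0" "nat_multiple m c = 0" for m
  proof -
    have "s \<in> (\<lambda>i. nat_multiple i c) ` {..<m}" for s
    proof -
      obtain i where "s = nat_multiple i c"
        using assms(3) unfolding generates_def by metis
      then show ?thesis
        using nat_multiple_mod[OF that(2), of i] that(1) 
        by (intro image_eqI[of _ _ "i mod m"]) simp_all
    qed
    then have "UNIV = (\<lambda>i. nat_multiple i c) ` {..<m}" by blast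
    then have "n = card ((\<lambda>i. nat_multiple i c) ` {..<m})"
      using assms(1) by simp
    then show "n \<le> m"
      using card_image_le[of "{..<m}" "\<lambda>i. nat_multiple i c"] by simp
  qed
  have "inj_on (\<lambda>i. nat_multiple i c) {..<n}"
  proof (rule linorder_inj_onI)
    fix i j assume ij: "i < j" "j \<in> {..<n}"
    show "nat_multiple i c \<noteq> nat_multiple j c"
    proof
      assume "nat_multiple i c = nat_multiple j c"
      from no_smaller[OF _ nat_multiple_diff[OF _ this]] ij show False by simp
    qed
  qed auto
  then have "card ((\<lambda>i. nat_multiple i c) ` {..<n}) = CARD('c)"
    using assms(1) by (simp add: card_image)
  moreover have "finite (UNIV :: 'c set)"
    using assms(1,2) card_ge_0_finite by blast
  ultimately have "(\<lambda>i. nat_multiple i c) ` {..<n} = UNIV"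
    by (intro card_subset_eq) simp_all
  then have "nat_multiple n c \<in> (\<lambda>i. nat_multiple i c) ` {..<n}"
    by simp
  then obtain i0 where i0: "i0 < n" "nat_multiple i0 c = nat_multiple n c"
    by (elim imageE) simp
  have "n \<le> n - i0"
    using no_smaller[OF _ nat_multiple_diff[OF _ i0(2)]] i0(1) by simp
  with i0 have n: "nat_multiple n c = 0" by (cases "i0 = 0") simp_all
  show ?thesis
  proof
    assume "nat_multiple i c = 0"
    then have "nat_multiple (i mod n) c = 0"
      using nat_multiple_mod[OF n, of i] by simp
    with no_smaller[of "i mod n"] assms(2) have "i mod n = 0"
      by (metis gr0I linorder_not_less mod_less_divisor)
    then show "n dvd i" by blast
  next
    assume "n dvd i"
    then show "nat_multiple i c = 0"
      using nat_multiple_mult_eq_0[OF n] by auto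
  qed
qed

lemma power_eq_of_nat_multiple_eq:
  fixes c :: "'c::group_add" and \<omega> :: "'k::field"
  assumes cyc: "CARD('c) = n" "n > 0" "generates c" and \<omega>: "\<omega> ^ n = 1"
    and eq: "nat_multiple i c = nat_multiple j c"
  shows "\<omega> ^ i = \<omega> ^ j"
  using eq
proof (induction i j rule: linorder_wlog)
  case (le i j)
  then have "nat_multiple (j - i) c = 0"
    by (rule nat_multiple_diff)
  then have "n dvd j - i"
    using nat_multiple_eq_0_iff[OF cyc] by simp
  then have "\<omega> ^ (j - i) = 1"
    using \<omega> by (auto simp: power_mult)
  then show ?case
    using power_add[of \<omega> i "j - i"] le by simp
next
  case (sym i j)
  then show ?case by metis
qed

text \<open>
  The exponent is a discrete logarithm, unique only modulo the order of \<open>c\<close>.  If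
  \<open>\<omega> ^ n = 1\<close> for this order \<open>n\<close>, every other choice gives the same value, by
  \<open>power_eq_of_nat_multiple_eq\<close>.
\<close>

definition cyclic_character :: "'g::group_add \<Rightarrow> 'k::field \<Rightarrow> 'g \<Rightarrow> 'k" where
  "cyclic_character c \<omega> s = \<omega> ^ (LEAST i. nat_multiple i c = s)"

lemma cyclic_character_nat_multiple:
  fixes c :: "'c::group_add" and \<omega> :: "'k::field"
  assumes "CARD('c) = n" "n > 0" "generates c" "\<omega> ^ n = 1"
  shows "cyclic_character c \<omega> (nat_multiple i c) = \<omega> ^ i"
  unfolding cyclic_character_def
  by (rule power_eq_of_nat_multiple_eq[OF assms])
     (rule LeastI[where P = "\<lambda>j. nat_multiple j c = nat_multiple i c" and k = i], rule refl)

lemma is_character_cyclic: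
  fixes c :: "'c::group_add" and \<omega> :: "'k::field"
  assumes "CARD('c) = n" "n > 0" "generates c" "\<omega> ^ n = 1"
  shows "is_character (cyclic_character c \<omega>)"
  unfolding is_character_def
proof (intro conjI allI)
  note at_multiple = cyclic_character_nat_multiple[OF assms]
  show "cyclic_character c \<omega> 0 = 1"
    using at_multiple[of 0] by simp
  fix s t
  obtain i where "s = nat_multiple i c"
    using assms(3) unfolding generates_def by metis
  moreover obtain j where "t = nat_multiple j c"
    using assms(3) unfolding generates_def by metis
  ultimately show "cyclic_character c \<omega> (s + t) = cyclic_character c \<omega> s * cyclic_character c \<omega> t"
    by (simp add: at_multiple power_add flip: nat_multiple_add)
qed

lemma character_nat_multiple:
  assumes "is_character \<chi>"
  shows "\<chi> (nat_multiple i c) = \<chi> c ^ i"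
  using assms by (induction i) (simp_all add: is_character_def)

lemma character_of_cyclic:
  fixes c :: "'c::group_add" and \<chi> :: "'c \<Rightarrow> 'k::field"
  assumes "CARD('c) = n" "n > 0" "generates c" "is_character \<chi>"
  shows "\<chi> c ^ n = 1" "\<chi> = cyclic_character c (\<chi> c)"
proof -
  show root: "\<chi> c ^ n = 1"
    using character_nat_multiple[OF assms(4), of n c] nat_multiple_eq_0_iff[OF assms(1-3), of n]
        assms(4)
    by (simp add: is_character_def)
  show "\<chi> = cyclic_character c (\<chi> c)"
  proof
    fix s
    obtain i where "s = nat_multiple i c"
      using assms(3) unfolding generates_def by metis
    then show "\<chi> s = cyclic_character c (\<chi> c) s"
      by (simp add: character_nat_multiple[OF assms(4)] cyclic_character_nat_multiple[OF
          assms(1-3) root])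
  qed
qed

theorem proposition4p3:
  fixes n :: nat and c :: "'c::group_add"
  assumes "CHAR('k::field) \<noteq> 2"
    and "n > 0"
    and "CARD('c) = n"
    and "generates c"
  shows "\<exists>\<Phi>. bij_betw \<Phi> {\<omega>::'k. \<omega> ^ n = 1}
             {(l, r). matched_pair (sweedler_hopf_algebra :: (sweedler_basis, 'k) hopf_algebra)
                        (group_hopf_algebra :: ('c, 'k) hopf_algebra) l r} \<and>
           (\<forall>\<omega> l r. \<omega> ^ n = 1 \<longrightarrow> \<Phi> \<omega> = (l, r) \<longrightarrow>
              (\<forall>i<n.
                 l (bv c ^ i \<otimes> bv B1) = bv c ^ i \<and>
                 l (bv c ^ i \<otimes> bv Bg) = bv c ^ i \<and>
                 l (bv c ^ i \<otimes> bv Bx) = 0 \<and>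
                 l (bv c ^ i \<otimes> bv Bgx) = 0 \<and>
                 r (bv c ^ i \<otimes> bv B1) = bv B1 \<and>
                 r (bv c ^ i \<otimes> bv Bg) = bv Bg \<and>
                 r (bv c ^ i \<otimes> bv Bx) = smul (\<omega> ^ i) (bv Bx) \<and>
                 r (bv c ^ i \<otimes> bv Bgx) = smul (\<omega> ^ i) (bv Bgx)))"
proof -
  note cyc = assms(3,2,4)
  define \<Phi> where "\<Phi> \<omega> = (trivial_action :: ('c \<times> sweedler_basis \<Rightarrow>\<^sub>0 'k) \<Rightarrow> _,
      character_action (cyclic_character c \<omega>))" for \<omega> :: 'k
  have "inj_on \<Phi> {\<omega>. \<omega> ^ n = 1}"
  proof (rule inj_onI)
    fix \<omega> \<omega>' :: 'k
    assume roots: "\<omega> \<in> {\<omega>. \<omega> ^ n = 1}" "\<omega>' \<in> {\<omega>. \<omega> ^ n = 1}" and "\<Phi> \<omega> = \<Phi> \<omega>'"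
    then have "character_action (cyclic_character c \<omega>) (bv (c, Bx)) =
        character_action (cyclic_character c \<omega>') (bv (c, Bx))"
      by (simp add: \<Phi>_def)
    from arg_cong[OF this, of "\<lambda>v. Poly_Mapping.lookup v Bx"]
    have "cyclic_character c \<omega> c = cyclic_character c \<omega>' c"
      by (simp add: character_action_def)
    then show "\<omega> = \<omega>'"
      using cyclic_character_nat_multiple[OF cyc, of \<omega> 1] cyclic_character_nat_multiple[OF cyc,
          of \<omega>' 1] roots
      by simp
  qed
  moreover have "\<Phi> ` {\<omega>. \<omega> ^ n = 1} = {(l, r). matched_pair sweedler_hopf_algebra
      group_hopf_algebra l r}"
  proof (intro subset_antisym subsetI)
    fix p assume "p \<in> \<Phi> ` {\<omega>. \<omega> ^ n = 1}"
    then show "p \<in> {(l, r). matched_pair sweedler_hopf_algebra group_hopf_algebra l r}"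
      using matched_pair_character[OF is_character_cyclic[OF cyc]] by (auto simp: \<Phi>_def)
  next
    fix p assume "p \<in> {(l, r). matched_pair
      (sweedler_hopf_algebra :: (sweedler_basis, 'k) hopf_algebra) 
      (group_hopf_algebra :: ('c, 'k) hopf_algebra) l r}"
    then obtain \<chi> where \<chi>: "is_character \<chi>" and p: "p = (trivial_action, character_action \<chi>)"
      by (auto elim: matched_pair_imp_character[OF assms(1)])
    have "p = \<Phi> (\<chi> c)"
      using character_of_cyclic(2)[OF cyc \<chi>] by (simp add: p \<Phi>_def)
    with character_of_cyclic(1)[OF cyc \<chi>] show "p \<in> \<Phi> ` {\<omega>. \<omega> ^ n = 1}" by blast
  qed
  ultimately have "bij_betw \<Phi> {\<omega>. \<omega> ^ n = 1} {(l, r). matched_pair sweedler_hopf_algebra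
      group_hopf_algebra l r}"
    by (simp add: bij_betw_def)
  then show ?thesis
    by (intro exI[of _ \<Phi>])
       (auto simp: \<Phi>_def bv_power trivial_action_def character_action_def lookup_single
          cyclic_character_nat_multiple[OF cyc])
qed

end
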